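(* Let $\Gamma$ be a connected weak metacirculant whose number of vertices is a power of an odd prime. Then $\Gamma$ is a metacirculant if and only if $\Gamma$ is a split weak metacirculant.
   Context: All graphs are finite, simple and undirected. A group $G$ is metacyclic if it has a cyclic normal subgroup $N$ with $G/N$ cyclic; it is split metacyclic if moreover $G \cong C_n : C_m$ (a semidirect product of cyclic groups, with the cyclic normal subgroup $C_n$). For integers $m\ge 1$, $n\ge 2$, a graph $\Gamma$ of order $mn$ is an $(m,n)$-metacirculant if it has an automorphism $\sigma$ of order $n$ such that $\langle\sigma\rangle$ acts semiregularly on $V(\Gamma)$ (all stabilizers trivial), and an automorphism $\tau$ normalizing $\langle\sigma\rangle$ that cyclically permutes the $m$ orbits of $\langle\sigma\rangle$ and has a cycle of length $m$ in its cycle decomposition. A metacirculant is an $(m,n)$-metacirculant for some $m,n$. A weak metacirculant is a graph whose automorphism group contains a metacyclic subgroup acting transitively on the vertex set. A weak metacirculant is a split weak metacirculant if its full automorphism group contains a vertex-transitive split metacyclic subgroup. *)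

theory Defs
  imports "HOL-Algebra.Algebra" "HOL-Combinatorics.Orbits" "HOL-Computational_Algebra.Primes"
    "Graph_Theory.Graph_Theory"
begin

text \<open>A finite simple undirected graph is a \<open>pair_graph\<close>: finitely many vertices and
  a symmetric, loopless adjacency relation \<open>parcs\<close>.\<close>

definition graph_auto :: "'a pair_pre_digraph \<Rightarrow> ('a \<Rightarrow> 'a) set" where
  "graph_auto \<Gamma> = {f \<in> Bij (pverts \<Gamma>).
     \<forall>u\<in>pverts \<Gamma>. \<forall>v\<in>pverts \<Gamma>. (f u, f v) \<in> parcs \<Gamma> \<longleftrightarrow> (u, v) \<in> parcs \<Gamma>}"

definition GraphAut :: "'a pair_pre_digraph \<Rightarrow> ('a \<Rightarrow> 'a) monoid" where
  "GraphAut \<Gamma> = BijGroup (pverts \<Gamma>) \<lparr>carrier := graph_auto \<Gamma>\<rparr>"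

lemma subgroup_graph_auto: "subgroup (graph_auto \<Gamma>) (BijGroup (pverts \<Gamma>))"
proof (rule subgroup.intro)
  let ?V = "pverts \<Gamma>"
  show "graph_auto \<Gamma> \<subseteq> carrier (BijGroup ?V)"
    by (auto simp: graph_auto_def BijGroup_def)
  show "x \<otimes>\<^bsub>BijGroup ?V\<^esub> y \<in> graph_auto \<Gamma>"
    if "x \<in> graph_auto \<Gamma>" "y \<in> graph_auto \<Gamma>" for x y
  proof -
    have xy: "x \<in> Bij ?V" "y \<in> Bij ?V" using that by (auto simp: graph_auto_def)
    have y: "y u \<in> ?V" if "u \<in> ?V" for u
      using Bij_imp_funcset[OF xy(2)] that by blast
    show ?thesis
      using that xy y by (auto simp: graph_auto_def BijGroup_def compose_Bij compose_eq)
  qed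
  show "\<one>\<^bsub>BijGroup ?V\<^esub> \<in> graph_auto \<Gamma>"
    by (auto simp: graph_auto_def BijGroup_def id_Bij)
  show "inv\<^bsub>BijGroup ?V\<^esub> x \<in> graph_auto \<Gamma>" if x: "x \<in> graph_auto \<Gamma>" for x
  proof -
    have xB: "x \<in> Bij ?V" using x by (auto simp: graph_auto_def)
    then have im: "x ` ?V = ?V" by (auto simp: Bij_def bij_betw_def)
    have "(inv_into ?V x u, inv_into ?V x v) \<in> parcs \<Gamma> \<longleftrightarrow> (u, v) \<in> parcs \<Gamma>"
      if "u \<in> ?V" "v \<in> ?V" for u v
    proof -
      have "(x (inv_into ?V x u), x (inv_into ?V x v)) \<in> parcs \<Gamma>
              \<longleftrightarrow> (inv_into ?V x u, inv_into ?V x v) \<in> parcs \<Gamma>"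
        using x that Bij_inv_into_mem[OF xB] unfolding graph_auto_def by blast
      then show ?thesis using that im by (simp add: f_inv_into_f)
    qed
    then show ?thesis
      using xB by (simp add: inv_BijGroup graph_auto_def restrict_inv_into_Bij)
  qed
qed

lemma group_GraphAut: "group (GraphAut \<Gamma>)"
  unfolding GraphAut_def
  by (rule subgroup.subgroup_is_group[OF subgroup_graph_auto group_BijGroup])

definition metacyclic :: "('a, 'b) monoid_scheme \<Rightarrow> bool" where
  "metacyclic G \<longleftrightarrow>
     (\<exists>N. N \<lhd> G \<and> cyclic_group (G\<lparr>carrier := N\<rparr>) \<and> cyclic_group (G Mod N))"

text \<open>\<open>G = N : H\<close>, as an internal semidirect product with normal factor \<open>N\<close>.\<close>

definition semidirect_product :: "('a, 'b) monoid_scheme \<Rightarrow> 'a set \<Rightarrow> 'a set \<Rightarrow> bool" where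
  "semidirect_product G N H \<longleftrightarrow>
     N \<lhd> G \<and> subgroup H G \<and> N \<inter> H = {\<one>\<^bsub>G\<^esub>} \<and> N <#>\<^bsub>G\<^esub> H = carrier G"

definition split_metacyclic :: "('a, 'b) monoid_scheme \<Rightarrow> bool" where
  "split_metacyclic G \<longleftrightarrow> metacyclic G \<and>
     (\<exists>N H. semidirect_product G N H \<and>
        cyclic_group (G\<lparr>carrier := N\<rparr>) \<and> cyclic_group (G\<lparr>carrier := H\<rparr>))"

text \<open>Groups of automorphisms are groups of permutations of the vertices, so their action is
  given by \<open>id\<close>.  The number of \<open>\<langle>\<sigma>\<rangle>\<close>-orbits is not stipulated to be \<open>m\<close>: this follows from
  semiregularity and the order of the graph.  \<open>Group_Action.orbits\<close> is the set of orbits of a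
  group, whereas \<open>Orbits.orbit \<tau> v\<close> and \<open>cyclic_on\<close> concern iteration of a single map:
  the former is the (support of the) cycle of \<open>\<tau>\<close> through \<open>v\<close>, fixed points being cycles
  of length 1.\<close>

definition mn_metacirculant :: "nat \<Rightarrow> nat \<Rightarrow> 'a pair_pre_digraph \<Rightarrow> bool" where
  "mn_metacirculant m n \<Gamma> \<longleftrightarrow>
     m \<ge> 1 \<and> n \<ge> 2 \<and> card (pverts \<Gamma>) = m * n \<and>
     (\<exists>\<sigma>\<in>carrier (GraphAut \<Gamma>). \<exists>\<tau>\<in>carrier (GraphAut \<Gamma>).
        let C = generate (GraphAut \<Gamma>) {\<sigma>};
            S = GraphAut \<Gamma> \<lparr>carrier := C\<rparr>
        in group.ord (GraphAut \<Gamma>) \<sigma> = n \<and>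
           (\<forall>v\<in>pverts \<Gamma>. stabilizer S id v = {\<one>\<^bsub>S\<^esub>}) \<and>
           \<tau> \<in> normalizer (GraphAut \<Gamma>) C \<and>
           cyclic_on (\<lambda>B. \<tau> ` B) (Group_Action.orbits S (pverts \<Gamma>) id) \<and>
           (\<exists>v\<in>pverts \<Gamma>. card (Orbits.orbit \<tau> v) = m))"

definition metacirculant :: "'a pair_pre_digraph \<Rightarrow> bool" where
  "metacirculant \<Gamma> \<longleftrightarrow> (\<exists>m n. mn_metacirculant m n \<Gamma>)"

definition weak_metacirculant :: "'a pair_pre_digraph \<Rightarrow> bool" where
  "weak_metacirculant \<Gamma> \<longleftrightarrow>
     (\<exists>R. subgroup R (GraphAut \<Gamma>) \<and> metacyclic (GraphAut \<Gamma> \<lparr>carrier := R\<rparr>) \<and>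
        transitive_action (GraphAut \<Gamma> \<lparr>carrier := R\<rparr>) (pverts \<Gamma>) id)"

definition split_weak_metacirculant :: "'a pair_pre_digraph \<Rightarrow> bool" where
  "split_weak_metacirculant \<Gamma> \<longleftrightarrow> weak_metacirculant \<Gamma> \<and>
     (\<exists>R. subgroup R (GraphAut \<Gamma>) \<and> split_metacyclic (GraphAut \<Gamma> \<lparr>carrier := R\<rparr>) \<and>
        transitive_action (GraphAut \<Gamma> \<lparr>carrier := R\<rparr>) (pverts \<Gamma>) id)"

end

theory Submission
  imports Defs "HOL-Number_Theory.Residues"
begin

text \<open>If \<open>\<Gamma>\<close> is an \<open>(m, n)\<close>-metacirculant, a power of \<open>\<tau>\<close> lying in \<open>\<langle>\<sigma>\<rangle>\<close> fixes every \<open>\<langle>\<sigma>\<rangle>\<close>-orbit, so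
  its exponent is a multiple of \<open>m\<close>; it then fixes a point of the \<open>m\<close>-cycle of \<open>\<tau>\<close> and is trivial by
  semiregularity.  Hence \<open>\<langle>\<sigma>\<rangle>\<langle>\<tau>\<rangle>\<close> is a split metacyclic transitive group.

  Conversely, let \<open>\<langle>a\<rangle> : \<langle>b\<rangle>\<close> be transitive on \<open>p\<^sup>k\<close> points.  The normal factor \<open>\<langle>a\<rangle>\<close> is semiregular,
  hence a \<open>p\<close>-group with \<open>m = p\<^sup>d\<close> orbits, and \<open>b\<close> may be replaced by its \<open>p\<close>-part.  Some
  \<open>a\<^sup>i b\<^sup>m\<close> fixes a point.  If \<open>b a b\<^sup>-\<^sup>1 = a\<^sup>r\<close> then \<open>(a\<^sup>j b)\<^sup>m = a\<^sup>j\<^sup>s b\<^sup>m\<close> with \<open>s = 1 + r + \<dots> + r\<^sup>m\<^sup>-\<^sup>1\<close>, and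
  since \<open>p\<close> is odd and \<open>r \<equiv> 1 (mod p)\<close>, \<open>s\<close> is \<open>m\<close> times a number prime to \<open>p\<close>.  So it remains to see that \<open>m\<close> divides \<open>i\<close>
  (or \<open>a\<^sup>i = 1\<close>): then \<open>\<tau> = a\<^sup>j b\<close> has a cycle of length \<open>m\<close> for a suitable \<open>j\<close>.\<close>

section \<open>Geometric sums modulo powers of an odd prime\<close>

lemma sum_power_mult:
  fixes r :: nat
  shows "(\<Sum>i<m * q. r ^ i) = (\<Sum>i<m. r ^ i) * (\<Sum>i<q. (r ^ m) ^ i)"
proof (induction q)
  case (Suc q)
  \<comment> \<open>The last block of terms is \<open>r ^ (m * q)\<close> times the initial block.
    An arbitrary block length \<open>l\<close> allows induction on \<open>l\<close>; the case needed
    is \<open>l = m\<close>.\<close>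
  have "(\<Sum>i<m * q + l. r ^ i) = (\<Sum>i<m * q. r ^ i) + r ^ (m * q) * (\<Sum>i<l. r ^ i)" for l
    by (induction l) (simp_all add: power_add algebra_simps)
  from this[of m] Suc show ?case
    by (simp add: power_mult algebra_simps)
qed simp

lemma power_eq_one_plus_sum:
  fixes r :: nat
  assumes "r \<ge> 1"
  shows "r ^ m = 1 + (r - 1) * (\<Sum>i<m. r ^ i)"
proof (induction m)
  case (Suc m)
  obtain s where "r = Suc s" using assms by (cases r) auto
  then show ?case using Suc by (simp add: algebra_simps)
qed simp

text \<open>With \<open>r = 1 + p * s\<close>, the binomial expansion modulo
  \<open>p\<^sup>2\<close> stops after the linear term, so the sum is \<open>p\<close> plus
  \<open>p * s\<close> times a triangular number. That number is divisible by \<open>p\<close>, so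
  the sum is \<open>p\<close> modulo \<open>p\<^sup>2\<close> and its cofactor is 1 modulo
  \<open>p\<close>.\<close>

lemma sum_power_odd_prime:
  fixes r p :: nat
  assumes p: "Factorial_Ring.prime p" "odd p" and r: "[r = 1] (mod p)"
  shows "\<exists>u. (\<Sum>i<p. r ^ i) = p * u \<and> coprime p u"
proof -
  have "r \<noteq> 0"
    using r p by (metis cong_0_1_nat cong_sym not_prime_1)
  then have "r \<ge> 1" by simp
  with r have "p dvd r - 1" by (metis cong_altdef_nat)
  then obtain s where s: "r = 1 + p * s" using \<open>r \<ge> 1\<close> by (metis dvdE le_add_diff_inverse)
  have pow: "[r ^ i = 1 + i * (p * s)] (mod p\<^sup>2)" for i
  proof (induction i)
    case (Suc i)
    have "[r ^ Suc i = (1 + p * s) * (1 + i * (p * s))] (mod p\<^sup>2)"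
      using cong_mult[OF cong_refl Suc, of r] s by simp
    also have "(1 + p * s) * (1 + i * (p * s)) = (1 + Suc i * (p * s)) + p\<^sup>2 * (i * s * s)"
      by (simp add: algebra_simps power2_eq_square)
    also have "[\<dots> = 1 + Suc i * (p * s)] (mod p\<^sup>2)"
      by (simp add: cong_def)
    finally show ?case .
  qed simp
  \<comment> \<open>Oddness of \<open>p\<close> enters here: the triangular number
    \<open>0 + \<dots> + (p - 1)\<close> is \<open>h * p\<close>, a multiple of
    \<open>p\<close>.\<close>
  obtain h where h: "p = 2 * h + 1" using p(2) by (elim oddE)
  have "(\<Sum>i<2 * h + 1. i) = h * (2 * h + 1)" by (induction h) auto
  then have tri: "(\<Sum>i<p. i) = h * p" using h by simp
  have "[(\<Sum>i<p. r ^ i) = (\<Sum>i<p. 1 + i * (p * s))] (mod p\<^sup>2)"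
    by (intro cong_sum pow)
  also have "(\<Sum>i<p. 1 + i * (p * s)) = p + (\<Sum>i<p. i) * (p * s)"
    by (subst sum.distrib) (simp flip: sum_distrib_right)
  also have "\<dots> = p + p\<^sup>2 * (h * s)"
    using tri by (simp add: power2_eq_square)
  also have "[\<dots> = p] (mod p\<^sup>2)" by (simp add: cong_def)
  finally have c: "[(\<Sum>i<p. r ^ i) = p * 1] (mod p * p)" by (simp add: power2_eq_square)
  then have "p dvd (\<Sum>i<p. r ^ i)"
    by (metis cong_dvd_iff cong_dvd_modulus_nat dvd_triv_left)
  then obtain u where u: "(\<Sum>i<p. r ^ i) = p * u" by blast
  with c have "[u = 1] (mod p)"
    using p(1) by (metis cong_def mod_mult_mult1 mult_cancel_left not_prime_0)
  then have "coprime p u" by (metis cong_imp_coprime cong_sym coprime_1_left coprime_commute)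
  with u show ?thesis by blast
qed

text \<open>Induction on \<open>t\<close>: the sum of length \<open>p ^ Suc t\<close> is the sum of
  length \<open>p ^ t\<close> times a sum of length \<open>p\<close> in powers of
  \<open>r ^ p ^ t\<close>, which is again 1 modulo \<open>p\<close>. Each step contributes exactly
  one factor \<open>p\<close>.\<close>

lemma sum_power_prime_power:
  fixes r p :: nat
  assumes p: "Factorial_Ring.prime p" "odd p" and r: "[r = 1] (mod p)"
  shows "\<exists>u. (\<Sum>i<p ^ t. r ^ i) = p ^ t * u \<and> coprime p u"
proof (induction t)
  case (Suc t)
  then obtain u where u: "(\<Sum>i<p ^ t. r ^ i) = p ^ t * u" "coprime p u" by blast
  have "[r ^ p ^ t = 1] (mod p)" using cong_pow[OF r] by simp
  from sum_power_odd_prime[OF p this]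
  obtain w where w: "(\<Sum>i<p. (r ^ p ^ t) ^ i) = p * w" "coprime p w" by blast
  have "(\<Sum>i<p ^ Suc t. r ^ i) = p ^ Suc t * (u * w)"
    using sum_power_mult[of r "p ^ t" p] u w by (simp add: mult_ac)
  moreover have "coprime p (u * w)" using u w by simp
  ultimately show ?case by blast
qed (auto intro: exI[of _ 1])

text \<open>In \<open>r ^ p ^ t - 1 = (r - 1) * (\<Sum>i<p ^ t. r ^ i)\<close> the first factor
  supplies one \<open>p\<close> and the geometric sum supplies \<open>p ^ t\<close>.\<close>

lemma power_prime_power_cong_one:
  fixes r p :: nat
  assumes p: "Factorial_Ring.prime p" "odd p" and r: "[r = 1] (mod p)"
  shows "[r ^ p ^ t = 1] (mod p ^ Suc t)"
proof -
  have "r \<noteq> 0"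
    using r p by (metis cong_0_1_nat cong_sym not_prime_1)
  then have 1: "r \<ge> 1" by simp
  with r have "p dvd r - 1" by (metis cong_altdef_nat)
  moreover have "p ^ t dvd (\<Sum>i<p ^ t. r ^ i)"
    using sum_power_prime_power[OF p r, of t] by auto
  ultimately have "p ^ Suc t dvd (r - 1) * (\<Sum>i<p ^ t. r ^ i)"
    by (simp add: mult_dvd_mono)
  then show ?thesis
    unfolding power_eq_one_plus_sum[OF 1, of "p ^ t"]
    by (simp only: cong_add_lcancel_0_nat cong_0_iff)
qed

section \<open>Powers of elements satisfying
  \<open>b \<otimes> a = a [^] r \<otimes> b\<close>\<close>

context group begin

lemma conj_pow:
  assumes ab: "a \<in> carrier G" "b \<in> carrier G" and r: "b \<otimes> a = a [^] (r::nat) \<otimes> b"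
  shows "b \<otimes> a [^] (i::nat) = a [^] (i * r) \<otimes> b"
proof (induction i)
  case (Suc i)
  have "b \<otimes> a [^] Suc i = (b \<otimes> a [^] i) \<otimes> a" using ab by (simp add: m_assoc)
  also have "\<dots> = a [^] (i * r) \<otimes> (b \<otimes> a)" using ab Suc by (simp add: m_assoc)
  also have "\<dots> = a [^] (i * r) \<otimes> a [^] r \<otimes> b" using ab r by (simp add: m_assoc)
  also have "\<dots> = a [^] (Suc i * r) \<otimes> b"
    using ab by (simp add: nat_pow_mult add.commute)
  finally show ?case .
qed (use ab in simp)

lemma pow_conj_pow:
  assumes ab: "a \<in> carrier G" "b \<in> carrier G" and r: "b \<otimes> a = a [^] (r::nat) \<otimes> b"
  shows "b [^] (j::nat) \<otimes> a [^] (i::nat) = a [^] (i * r ^ j) \<otimes> b [^] j"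
proof (induction j arbitrary: i)
  case (Suc j)
  have "b [^] Suc j \<otimes> a [^] i = b [^] j \<otimes> (b \<otimes> a [^] i)" using ab by (simp add: m_assoc)
  also have "\<dots> = (b [^] j \<otimes> a [^] (i * r)) \<otimes> b"
    using ab conj_pow[OF ab r] by (simp add: m_assoc)
  also have "\<dots> = a [^] (i * r ^ Suc j) \<otimes> b [^] Suc j"
    using ab Suc by (simp add: m_assoc mult_ac)
  finally show ?case .
qed (use ab in simp)

text \<open>Collecting all factors \<open>b\<close> on the right, the copy of \<open>a [^] i\<close>
  preceded by \<open>l\<close> of them has its exponent multiplied by \<open>r ^ l\<close>.\<close>

lemma pow_mult_conj:
  assumes ab: "a \<in> carrier G" "b \<in> carrier G" and r: "b \<otimes> a = a [^] (r::nat) \<otimes> b"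
  shows "(a [^] (i::nat) \<otimes> b) [^] (m::nat) = a [^] (i * (\<Sum>l<m. r ^ l)) \<otimes> b [^] m"
proof (induction m)
  case (Suc m)
  have "(a [^] i \<otimes> b) [^] Suc m = a [^] (i * (\<Sum>l<m. r ^ l)) \<otimes> (b [^] m \<otimes> a [^] i) \<otimes> b"
    using ab Suc by (simp add: m_assoc)
  also have "\<dots> = (a [^] (i * (\<Sum>l<m. r ^ l)) \<otimes> a [^] (i * r ^ m)) \<otimes> b [^] Suc m"
    using ab pow_conj_pow[OF ab r, of m i] by (simp add: m_assoc)
  also have "\<dots> = a [^] (i * (\<Sum>l<Suc m. r ^ l)) \<otimes> b [^] Suc m"
    using ab by (simp add: nat_pow_mult algebra_simps)
  finally show ?case .
qed (use ab in simp)

text \<open>Elements of infinite order are covered too: there \<open>ord a\<close> is 0, and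
  congruence modulo 0 is equality.\<close>

lemma nat_pow_eq_iff_cong:
  assumes "a \<in> carrier G"
  shows "a [^] (i::nat) = a [^] (j::nat) \<longleftrightarrow> [i = j] (mod ord a)"
proof -
  have "a [^] i = a [^] j \<longleftrightarrow> [i = j] (mod ord a)" if "i \<le> j" for i j :: nat
  proof -
    have "a [^] j = a [^] i \<otimes> a [^] (j - i)" using assms that by (simp add: nat_pow_mult)
    then have "a [^] i = a [^] j \<longleftrightarrow> a [^] (j - i) = \<one>"
      using assms by (metis nat_pow_closed l_cancel_one' )
    then show ?thesis using assms that by (metis cong_altdef_nat cong_sym_eq pow_eq_id)
  qed
  then show ?thesis by (metis cong_sym_eq nat_le_linear)
qed

end

text \<open>Fermat's little theorem in the form \<open>x ^ p \<equiv> x\<close>, iterated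
  \<open>e\<close> times.\<close>

lemma power_prime_power_cong_self:
  fixes r p :: nat
  assumes "Factorial_Ring.prime p"
  shows "[r ^ p ^ e = r] (mod p)"
proof (induction e)
  case (Suc e)
  have "[x ^ p = x] (mod p)" for x :: nat
  proof (cases "p dvd x")
    case True
    moreover have "p dvd x ^ p" using True assms by (simp add: dvd_power_le prime_gt_0_nat dvd_trans[OF True])
    ultimately show ?thesis by (simp add: cong_def)
  next
    case False
    have "x ^ p = x * x ^ (p - 1)"
      using prime_gt_0_nat[OF assms] by (simp add: power_eq_if)
    then show ?thesis
      using cong_mult[OF cong_refl fermat_theorem[OF assms False], of x] by simp
  qed
  from this[of "r ^ p ^ e"] Suc have "[(r ^ p ^ e) ^ p = r] (mod p)" by (rule cong_trans)
  then show ?case by (simp add: mult.commute flip: power_mult)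
qed simp

section \<open>Bringing a \<open>p ^ d\<close>-th power into a core-free subgroup\<close>

context group begin

text \<open>Conjugation by \<open>b [^] (p ^ e) = \<one>\<close> is trivial, so
  \<open>r ^ p ^ e\<close> is 1 modulo \<open>ord a\<close>, hence modulo \<open>p\<close>; by
  Fermat it is also \<open>r\<close> modulo \<open>p\<close>.\<close>

lemma conj_exponent_cong_one:
  assumes p: "Factorial_Ring.prime p"
    and ab: "a \<in> carrier G" "b \<in> carrier G" and r: "b \<otimes> a = a [^] (r::nat) \<otimes> b"
    and "p dvd ord a" "ord b = p ^ e"
  shows "[r = 1] (mod p)"
proof -
  have "b [^] (p ^ e) = \<one>" using assms by (simp add: pow_eq_id)
  then have "a [^] (1::nat) = a [^] (r ^ p ^ e)"
    using pow_conj_pow[OF ab r, of "p ^ e" 1] ab by simp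
  then have "[1 = r ^ p ^ e] (mod ord a)" using ab nat_pow_eq_iff_cong by blast
  then have "[1 = r ^ p ^ e] (mod p)" using assms(5) cong_dvd_modulus_nat by blast
  then show ?thesis using power_prime_power_cong_self[OF p, of r e] by (metis cong_trans cong_sym)
qed

text \<open>If \<open>|b| > m = p\<^sup>d\<close>, some nontrivial power of \<open>a\<^sup>i b\<^sup>m\<close> has order \<open>p\<close>.  As \<open>K\<close> is core-free it is not
  central, which forces \<open>|b|\<close> to divide \<open>|a|\<close> and hence \<open>m\<close> to divide \<open>i\<close>.\<close>

lemma ex_prime_power_root_in_core_free:
  assumes p: "Factorial_Ring.prime p" "odd p"
    and ab: "a \<in> carrier G" "b \<in> carrier G" and r: "b \<otimes> a = a [^] (r::nat) \<otimes> b"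
    and orda: "ord a = p ^ f" and f: "f \<noteq> 0" and ordb: "ord b = p ^ e"
    and disj: "\<And>(x::nat) (y::nat). a [^] x \<otimes> b [^] y = \<one> \<Longrightarrow> b [^] y = \<one>"
    and K: "subgroup K G"
    and Ka: "\<And>x::nat. a [^] x \<in> K \<Longrightarrow> a [^] x = \<one>"
    and Kcentral: "\<And>z. z \<in> K \<Longrightarrow> z \<otimes> a = a \<otimes> z \<Longrightarrow> z \<otimes> b = b \<otimes> z \<Longrightarrow> z = \<one>"
    and de: "d \<le> e" and iK: "a [^] (i::nat) \<otimes> b [^] (p ^ d) \<in> K"
  shows "\<exists>j::nat. (a [^] j \<otimes> b) [^] (p ^ d) \<in> K"
proof -
  have r1: "[r = 1] (mod p)"
    using conj_exponent_cong_one[OF p(1) ab r _ ordb] orda f by (simp add: dvd_power)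
  define m c where "m = p ^ d" and "c = a [^] i \<otimes> b [^] m"
  have bm: "b [^] m \<otimes> a = a [^] (r ^ m) \<otimes> b [^] m"
    using pow_conj_pow[OF ab r, of m 1] ab by simp
  have rm1: "[r ^ m = 1] (mod p)" using cong_pow[OF r1] by simp
  have cK: "c [^] l \<in> K" for l :: nat
    using iK K by (induction l) (auto simp: c_def m_def subgroup.m_closed subgroup.one_closed)
  \<comment> \<open>Conjugation by \<open>b [^] m\<close> raises \<open>a\<close> to the power
    \<open>r ^ m\<close>, again 1 modulo \<open>p\<close>, so the geometric sum in the exponent is
    \<open>p ^ l\<close> times a number prime to \<open>p\<close>.\<close>
  have cpow: "\<exists>u. c [^] (p ^ l) = a [^] (i * (p ^ l * u)) \<otimes> b [^] (p ^ (d + l)) \<and> coprime p u" for l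
  proof -
    obtain u where "(\<Sum>j<p ^ l. (r ^ m) ^ j) = p ^ l * u" "coprime p u"
      using sum_power_prime_power[OF p rm1] by blast
    then show ?thesis
      using pow_mult_conj[OF ab(1) _ bm, of i "p ^ l"] ab
      by (auto simp: c_def m_def nat_pow_pow power_add)
  qed
  have copr: "coprime (p ^ l) u" if "coprime p u" for l u using that by simp
  \<comment> \<open>At this power of \<open>c\<close> the factor from \<open>b\<close> vanishes.
    What remains is a power of \<open>a\<close> in \<open>K\<close>, hence trivial, which bounds the
    \<open>p\<close>-part of \<open>i\<close> from below.\<close>
  obtain u where u: "c [^] (p ^ (e - d)) = a [^] (i * (p ^ (e - d) * u)) \<otimes> b [^] (p ^ e)" "coprime p u"
    using cpow[of "e - d"] de by auto
  have "b [^] (p ^ e) = \<one>" using ordb ab by (simp add: pow_eq_id)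
  with u cK[of "p ^ (e - d)"] ab have "a [^] (i * (p ^ (e - d) * u)) \<in> K" by simp
  then have "p ^ f dvd i * (p ^ (e - d) * u)" using Ka ab orda pow_eq_id by metis
  then have fdvd: "p ^ f dvd i * p ^ (e - d)"
    using copr[OF u(2)] by (metis coprime_dvd_mult_left_iff mult.assoc)
  show ?thesis
  proof (cases "d = e")
    case True
    then have "a [^] i = \<one>" using fdvd ab orda by (simp add: pow_eq_id)
    then have "(a [^] (0::nat) \<otimes> b) [^] (p ^ d) \<in> K" using iK ab by simp
    then show ?thesis by blast
  next
    case False
    \<comment> \<open>Otherwise the power \<open>z = c [^] (p ^ (e - d - 1))\<close>, one step
      before the \<open>b\<close>-part dies, commutes with both \<open>a\<close> and
      \<open>b\<close>. Lying in \<open>K\<close> it is then trivial, so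
      \<open>b [^] (p ^ (e - 1))\<close> is trivial, against the order of \<open>b\<close>.\<close>
    have "e \<le> f"
    proof (rule ccontr)
      assume "\<not> e \<le> f"
      define l where "l = e - d - 1"
      have l: "e = Suc (d + l)" "e - d = Suc l" using False de by (auto simp: l_def)
      obtain u where u: "c [^] (p ^ l) = a [^] (i * (p ^ l * u)) \<otimes> b [^] (p ^ (d + l))"
        using cpow by blast
      define w z where "w = i * (p ^ l * u)" and "z = c [^] (p ^ l)"
      have z: "z = a [^] w \<otimes> b [^] (p ^ (d + l))" using u by (simp add: w_def z_def)
      have zK: "z \<in> K" unfolding z_def by (rule cK)
      \<comment> \<open>Since \<open>ord a = p ^ f\<close> divides \<open>p ^ e\<close>, this makes
        the \<open>b\<close>-part of \<open>z\<close> commute with \<open>a\<close>.\<close>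
      have "[r ^ p ^ (d + l) = 1] (mod p ^ e)"
        using power_prime_power_cong_one[OF p r1, of "d + l"] l by simp
      then have "[r ^ p ^ (d + l) = 1] (mod ord a)"
        using \<open>\<not> e \<le> f\<close> orda by (metis cong_dvd_modulus_nat le_imp_power_dvd nat_le_linear)
      then have "a [^] (r ^ p ^ (d + l)) = a"
        using ab nat_pow_eq_iff_cong[of a _ 1] by simp
      then have "b [^] (p ^ (d + l)) \<otimes> a = a \<otimes> b [^] (p ^ (d + l))"
        using pow_conj_pow[OF ab r, of _ 1] ab by simp
      then have za: "z \<otimes> a = a \<otimes> z"
        using z ab by (metis m_assoc nat_pow_closed nat_pow_comm nat_pow_eone)
      \<comment> \<open>The exponent \<open>w\<close> lacks at most one factor \<open>p\<close> to
        kill \<open>a\<close>, and \<open>r - 1\<close> supplies it; hence \<open>b\<close> commutes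
        with \<open>a [^] w\<close>.\<close>
      have pw: "p ^ f dvd p * w"
        using dvd_mult2[OF fdvd, of u] l by (simp add: w_def mult_ac)
      have "[w * r = w] (mod p ^ f)"
      proof -
        have "r \<noteq> 0" using r1 p by (metis cong_0_1_nat cong_sym not_prime_1)
        then have "p dvd r - 1" using r1 by (metis cong_altdef_nat One_nat_def Suc_leI not_gr0)
        then have "p * w dvd w * (r - 1)" by (metis mult.commute mult_dvd_mono dvd_refl)
        with pw have "p ^ f dvd w * (r - 1)" by (rule dvd_trans)
        moreover have "w * r = w + w * (r - 1)" using \<open>r \<noteq> 0\<close> by (cases r) auto
        ultimately show ?thesis by (simp only: cong_add_lcancel_0_nat cong_0_iff)
      qed
      then have "b \<otimes> a [^] w = a [^] w \<otimes> b"
        using conj_pow[OF ab r, of w] nat_pow_eq_iff_cong[OF ab(1)] orda by metis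
      then have zb: "z \<otimes> b = b \<otimes> z"
        using z ab by (metis m_assoc nat_pow_closed nat_pow_comm nat_pow_eone)
      have "b [^] (p ^ (d + l)) = \<one>"
        by (rule disj[of w]) (use Kcentral[OF zK za zb] z in simp)
      then have "p ^ e dvd p ^ (d + l)" using pow_eq_id[OF ab(2)] ordb by metis
      then have "e \<le> d + l" using power_dvd_imp_le prime_gt_1_nat[OF p(1)] by blast
      then show False using l(1) by simp
    qed
    \<comment> \<open>Cancelling \<open>p ^ (e - d)\<close> leaves \<open>p ^ (f + d - e)\<close> as
      a divisor of \<open>i\<close>, and \<open>e \<le> f\<close> makes that exponent at least
      \<open>d\<close>.\<close>
    have "p ^ f = p ^ (f + d - e) * p ^ (e - d)"
      using \<open>e \<le> f\<close> de by (simp flip: power_add)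
    then have "p ^ (f + d - e) dvd i"
      using fdvd p(1) by (metis dvd_times_right_cancel_iff not_prime_0 power_not_zero)
    moreover have "d \<le> f + d - e" using \<open>e \<le> f\<close> by simp
    ultimately have "m dvd i" unfolding m_def by (meson dvd_trans le_imp_power_dvd)
    then obtain i' where i': "i = m * i'" by blast
    obtain u where u: "(\<Sum>j<m. r ^ j) = m * u" "coprime p u"
      using sum_power_prime_power[OF p r1] m_def by blast
    \<comment> \<open>The exponent \<open>j = x * i'\<close> is chosen so that \<open>j\<close>
      times the geometric sum \<open>m * u\<close> is \<open>i\<close> modulo \<open>ord a\<close>;
      then \<open>a [^] j \<otimes> b\<close> has the required \<open>m\<close>-th power.\<close>
    obtain x where "[u * x = 1] (mod p ^ f)"
      using cong_solve_coprime_nat[of u "p ^ f"] copr[OF u(2)] by (auto simp: coprime_commute)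
    from cong_mult[OF this cong_refl[of i]] have "[(x * i') * (\<Sum>j<m. r ^ j) = i] (mod ord a)"
      using u i' orda by (simp add: mult_ac)
    then have "a [^] ((x * i') * (\<Sum>j<m. r ^ j)) = a [^] i"
      using nat_pow_eq_iff_cong[OF ab(1)] by blast
    then have "(a [^] (x * i') \<otimes> b) [^] (p ^ d) = a [^] i \<otimes> b [^] (p ^ d)"
      unfolding pow_mult_conj[OF ab r] m_def by (rule arg_cong)
    with iK have "(a [^] (x * i') \<otimes> b) [^] (p ^ d) \<in> K" by metis
    then show ?thesis by blast
  qed
qed

end

section \<open>Cycle lengths of an iterated map\<close>

lemma funpow_eq_self_iff:
  assumes "0 < N" "(f ^^ N) s = s"
  shows "(f ^^ j) s = s \<longleftrightarrow> card (Orbits.orbit f s) dvd j"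
proof -
  \<comment> \<open>\<open>d\<close> is the least period of \<open>s\<close>; the orbit will consist
    of the \<open>d\<close> distinct iterates with index below \<open>d\<close>.\<close>
  define d where "d = (LEAST i. 0 < i \<and> (f ^^ i) s = s)"
  have d: "0 < d" "(f ^^ d) s = s"
    using LeastI[of "\<lambda>i. 0 < i \<and> (f ^^ i) s = s" N] assms by (auto simp: d_def)
  have least: "d \<le> i" if "0 < i" "(f ^^ i) s = s" for i
    unfolding d_def using that by (intro Least_le) simp
  \<comment> \<open>\<open>Orbits.orbit\<close> collects positive iterates only, so \<open>s\<close>
    itself belongs to it because it recurs.\<close>
  have self: "s \<in> Orbits.orbit f s"
    unfolding orbit_altdef using d by (intro CollectI exI[of _ d]) simp
  have dvd: "(f ^^ i) s = s \<longleftrightarrow> d dvd i" for i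
  proof -
    have "(f ^^ (i mod d)) s = (f ^^ i) s" using d(2) by (rule funpow_mod_eq)
    moreover have "(f ^^ (i mod d)) s = s \<longleftrightarrow> i mod d = 0"
      using least[of "i mod d"] d(1) by (metis funpow_0 gr0I mod_less_divisor not_le)
    ultimately show ?thesis by (simp add: dvd_eq_mod_eq_0)
  qed
  have "(f ^^ i) s \<in> (\<lambda>i. (f ^^ i) s) ` {..<d}" for i
    using funpow_mod_eq[OF d(2), of i] d(1) by (intro image_eqI[of _ _ "i mod d"]) simp_all
  then have "Orbits.orbit f s = (\<lambda>i. (f ^^ i) s) ` {..<d}"
    unfolding orbit_altdef_self_in[OF self] by blast
  moreover have "inj_on (\<lambda>i. (f ^^ i) s) {..<d}"
  proof (rule linorder_inj_onI)
    fix i j assume ij: "i < j" "i \<in> {..<d}" "j \<in> {..<d}"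
    show "(f ^^ i) s \<noteq> (f ^^ j) s"
    proof
      assume eq: "(f ^^ i) s = (f ^^ j) s"
      have "(f ^^ (d - j + i)) s = (f ^^ (d - j)) ((f ^^ j) s)" by (simp add: funpow_add eq)
      also have "\<dots> = s" using ij d(2) by (simp flip: funpow_add[THEN fun_cong, unfolded comp_def])
      finally show False using least[of "d - j + i"] ij by auto
    qed
  qed auto
  ultimately have "card (Orbits.orbit f s) = d" by (simp add: card_image)
  then show ?thesis using dvd by simp
qed

section \<open>Normalizers of cyclic subgroups\<close>

context group begin

lemma mem_normalizer_iff:
  assumes "H \<subseteq> carrier G"
  shows "g \<in> normalizer G H \<longleftrightarrow> g \<in> carrier G \<and> g <# H #> inv g = H"
  using assms by (simp add: normalizer_def stabilizer_def)

lemma l_coset_r_coset_inv: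
  "g <# H #> inv g = (\<lambda>h. g \<otimes> h \<otimes> inv g) ` H"
  by (auto simp: l_coset_def r_coset_def)

lemma generate_singleton_nat:
  assumes "a \<in> carrier G" "ord a \<noteq> 0"
  shows "generate G {a} = range (\<lambda>i::nat. a [^] i)"
  using generate_pow_nat[OF assms] by (simp add: full_SetCompr_eq)

text \<open>The relation only says that conjugation by \<open>b\<close> maps the cyclic group into
  itself; being injective on a finite set, it is onto.\<close>

lemma conj_pow_imp_mem_normalizer:
  assumes ab: "a \<in> carrier G" "b \<in> carrier G" and r: "b \<otimes> a = a [^] (r::nat) \<otimes> b"
    and "ord a \<noteq> 0"
  shows "b \<in> normalizer G (generate G {a})"
proof -
  let ?C = "generate G {a}"
  let ?f = "\<lambda>h. b \<otimes> h \<otimes> inv b"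
  have C: "?C \<subseteq> carrier G" using ab generate_incl by simp
  have "finite ?C"
    using generate_pow_card[OF ab(1)] assms(4) by (metis card.infinite)
  moreover have "?f ` ?C \<subseteq> ?C"
    unfolding generate_singleton_nat[OF ab(1) assms(4)]
    using conj_pow[OF ab r] ab by (auto simp: m_assoc)
  moreover have "inj_on ?f ?C"
  proof (rule inj_onI)
    fix x y assume "x \<in> ?C" "y \<in> ?C" and eq: "?f x = ?f y"
    then have "x \<in> carrier G" "y \<in> carrier G" using C by blast+
    then show "x = y" using eq ab by simp
  qed
  ultimately have "?f ` ?C = ?C" by (simp add: endo_inj_surj)
  then show ?thesis using ab C by (simp add: mem_normalizer_iff l_coset_r_coset_inv)
qed

end

section \<open>Orbits of a subgroup under its normalizer\<close>

context group_action begin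

lemma action_group: "group G"
  using group_hom group_hom.axioms(1) by blast

lemma action_closed: "g \<in> carrier G \<Longrightarrow> x \<in> E \<Longrightarrow> \<phi> g x \<in> E"
  using element_image by blast

lemma action_one: "x \<in> E \<Longrightarrow> \<phi> \<one> x = x"
  using id_eq_one by (metis restrict_apply')

lemma action_nat_pow:
  assumes "g \<in> carrier G" "x \<in> E"
  shows "\<phi> (g [^] (n::nat)) x = (\<phi> g ^^ n) x"
proof -
  interpret group G by (rule action_group)
  show ?thesis
  proof (induction n)
    case (Suc n)
    have "\<phi> (g [^] Suc n) x = \<phi> (g \<otimes> g [^] n) x"
      using assms nat_pow_Suc2 by metis
    then show ?case using Suc assms composition_rule by simp
  qed (use assms action_one in simp)
qed

text \<open>Moving \<open>g\<close> past \<open>h\<close> replaces \<open>h\<close> by its conjugate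
  \<open>g \<otimes> h \<otimes> inv g\<close>, and conjugation by \<open>g\<close> permutes
  \<open>C\<close>.\<close>

lemma image_orbit_normalizer:
  assumes C: "subgroup C G" and g: "g \<in> normalizer G C" and x: "x \<in> E"
  shows "\<phi> g ` Group_Action.orbit (G\<lparr>carrier := C\<rparr>) \<phi> x =
    Group_Action.orbit (G\<lparr>carrier := C\<rparr>) \<phi> (\<phi> g x)"
proof -
  interpret group G by (rule action_group)
  have CG: "C \<subseteq> carrier G" using C subgroup.subset by blast
  have gG: "g \<in> carrier G" and im: "(\<lambda>h. g \<otimes> h \<otimes> inv g) ` C = C"
    using g mem_normalizer_iff[OF CG] l_coset_r_coset_inv by auto
  have key: "\<phi> g (\<phi> h x) = \<phi> (g \<otimes> h \<otimes> inv g) (\<phi> g x)" if "h \<in> C" for h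
  proof -
    have h: "h \<in> carrier G" using that CG by blast
    have "\<phi> (g \<otimes> h \<otimes> inv g) (\<phi> g x) = \<phi> (g \<otimes> h \<otimes> inv g \<otimes> g) x"
      using h gG x by (simp add: composition_rule)
    also have "g \<otimes> h \<otimes> inv g \<otimes> g = g \<otimes> h" using h gG by (simp add: m_assoc)
    finally show ?thesis using h gG x by (simp add: composition_rule)
  qed
  have "\<phi> g ` {\<phi> h x | h. h \<in> C} = (\<lambda>h. \<phi> g (\<phi> h x)) ` C" by blast
  also have "\<dots> = (\<lambda>h. \<phi> (g \<otimes> h \<otimes> inv g) (\<phi> g x)) ` C"
    using key by (intro image_cong) auto
  also have "\<dots> = (\<lambda>h. \<phi> h (\<phi> g x)) ` ((\<lambda>h. g \<otimes> h \<otimes> inv g) ` C)" by (simp add: image_image)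
  also have "\<dots> = {\<phi> h (\<phi> g x) | h. h \<in> C}" unfolding im by blast
  finally show ?thesis by (simp add: Group_Action.orbit_def)
qed

lemma funpow_image_orbit_normalizer:
  assumes C: "subgroup C G" and g: "g \<in> normalizer G C" and x: "x \<in> E"
  shows "((\<lambda>B. \<phi> g ` B) ^^ j) (Group_Action.orbit (G\<lparr>carrier := C\<rparr>) \<phi> x) =
    Group_Action.orbit (G\<lparr>carrier := C\<rparr>) \<phi> (\<phi> (g [^] j) x)"
proof (induction j)
  case 0
  then show ?case using x action_one action_group by simp
next
  case (Suc j)
  interpret group G by (rule action_group)
  have gG: "g \<in> carrier G" using g mem_normalizer_iff C subgroup.subset by blast
  have "\<phi> g (\<phi> (g [^] j) x) = \<phi> (g [^] Suc j) x"
    using action_nat_pow[OF gG x, of "Suc j"] action_nat_pow[OF gG x, of j] by simp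
  then show ?case
    using Suc image_orbit_normalizer[OF C g, of "\<phi> (g [^] j) x"] gG x by (simp add: action_closed)
qed

lemma orbit_eq_iff:
  assumes "x \<in> E" "y \<in> E"
  shows "Group_Action.orbit G \<phi> x = Group_Action.orbit G \<phi> y \<longleftrightarrow> x \<in> Group_Action.orbit G \<phi> y"
proof
  assume "x \<in> Group_Action.orbit G \<phi> y"
  then have "x \<in> Group_Action.orbit G \<phi> x \<inter> Group_Action.orbit G \<phi> y"
    using assms orbit_refl by blast
  then show "Group_Action.orbit G \<phi> x = Group_Action.orbit G \<phi> y"
    using disjoint_union[of "Group_Action.orbit G \<phi> x" "Group_Action.orbit G \<phi> y"] assms
    by (auto simp: orbits_def)
qed (use assms orbit_refl in blast)

text \<open>By the orbit-stabilizer theorem every orbit has as many points as the group has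
  elements.\<close>

lemma card_semiregular:
  assumes "finite E" and semireg: "\<And>x. x \<in> E \<Longrightarrow> stabilizer G \<phi> x = {\<one>}"
  shows "card E = card (Group_Action.orbits G E \<phi>) * order G"
proof -
  have "card B = order G" if "B \<in> Group_Action.orbits G E \<phi>" for B
    using that orbit_stabilizer_theorem semireg by (auto simp: orbits_def)
  moreover have "card E = (\<Sum>B\<in>Group_Action.orbits G E \<phi>. card B)"
    using disjoint_sum[OF assms(1), of "\<lambda>_. 1::nat"] by simp
  ultimately show ?thesis by simp
qed

text \<open>By \<open>cover\<close>, the images of the \<open>C\<close>-orbit of \<open>x\<close>
  under the powers of \<open>g\<close> exhaust all \<open>C\<close>-orbits. So these form a single
  cycle, whose length is their number; the second claim is the period criterion for that
  cycle.\<close>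

lemma normalizer_cyclic_on_orbits:
  assumes C: "subgroup C G" and g: "g \<in> normalizer G C" and x: "x \<in> E"
    and ord: "group.ord G g \<noteq> 0"
    and cover: "\<And>y. y \<in> E \<Longrightarrow> \<exists>j::nat. y \<in> Group_Action.orbit (G\<lparr>carrier := C\<rparr>) \<phi> (\<phi> (g [^] j) x)"
  defines "S \<equiv> G\<lparr>carrier := C\<rparr>"
  shows "cyclic_on (\<lambda>B. \<phi> g ` B) (Group_Action.orbits S E \<phi>)"
    and "Group_Action.orbit S \<phi> (\<phi> (g [^] j) x) = Group_Action.orbit S \<phi> x
      \<longleftrightarrow> card (Group_Action.orbits S E \<phi>) dvd j"
proof -
  interpret group G by (rule action_group)
  interpret S: group_action S E \<phi> unfolding S_def using C by (rule induced_action)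
  let ?f = "\<lambda>B. \<phi> g ` B" and ?O = "Group_Action.orbit S \<phi>"
  have gG: "g \<in> carrier G" using g mem_normalizer_iff C subgroup.subset by blast
  have fp: "(?f ^^ j) (?O x) = ?O (\<phi> (g [^] j) x)" for j
    unfolding S_def by (rule funpow_image_orbit_normalizer[OF C g x])
  have per: "(?f ^^ ord g) (?O x) = ?O x"
    using fp[of "ord g"] gG x by (simp add: action_one)
  have self: "?O x \<in> Orbits.orbit ?f (?O x)"
    unfolding orbit_altdef using per ord by force
  have "Group_Action.orbits S E \<phi> = Orbits.orbit ?f (?O x)"
  proof (intro subset_antisym subsetI)
    fix B assume "B \<in> Group_Action.orbits S E \<phi>"
    then obtain y where y: "y \<in> E" "B = ?O y" by (auto simp: orbits_def)
    then obtain j where "y \<in> ?O (\<phi> (g [^] (j::nat)) x)" using cover S_def by blast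
    then have "B = ?O (\<phi> (g [^] j) x)"
      using y S.orbit_eq_iff[OF y(1)] x gG by (simp add: action_closed)
    then show "B \<in> Orbits.orbit ?f (?O x)"
      unfolding orbit_altdef_self_in[OF self] using fp by blast
  next
    fix B assume "B \<in> Orbits.orbit ?f (?O x)"
    then obtain j where "B = (?f ^^ j) (?O x)" unfolding orbit_altdef by blast
    then show "B \<in> Group_Action.orbits S E \<phi>"
      using fp x gG action_closed by (auto simp: orbits_def)
  qed
  note orbs = this
  show "cyclic_on ?f (Group_Action.orbits S E \<phi>)"
    unfolding cyclic_on_def using orbs self by blast
  show "?O (\<phi> (g [^] j) x) = ?O x \<longleftrightarrow> card (Group_Action.orbits S E \<phi>) dvd j"
    using funpow_eq_self_iff[OF _ per, of j] ord fp[of j] orbs by auto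
qed

end

section \<open>Elements with fixed points in a faithful action\<close>

context faithful_action begin

lemma fixes_all_imp_one:
  assumes "g \<in> carrier G" "\<And>x. x \<in> E \<Longrightarrow> \<phi> g x = x"
  shows "g = \<one>"
proof -
  interpret group G by (rule action_group)
  \<comment> \<open>Permutations in \<open>Bij E\<close> are extensional, so agreement with the
    identity on \<open>E\<close> is equality of functions.\<close>
  have "\<phi> g \<in> extensional E" using bij_prop0[OF assms(1)] by (rule Bij_imp_extensional)
  then have "\<phi> g = (\<lambda>x\<in>E. x)"
    using assms(2) by (intro extensionalityI[of _ E]) auto
  then have "\<phi> g = \<phi> \<one>" using id_eq_one by simp
  then show ?thesis using faithful assms(1) by (auto dest: inj_onD)
qed

text \<open>An element commuting with every \<open>a [^] i \<otimes> b [^] j\<close> fixes the image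
  under it of each point that it fixes; these products carry \<open>x\<close> to every
  point.\<close>

lemma commuting_fixes_imp_one:
  assumes ab: "a \<in> carrier G" "b \<in> carrier G" and x: "x \<in> E"
    and trans: "\<And>y. y \<in> E \<Longrightarrow> \<exists>(i::nat) (j::nat). y = \<phi> (a [^] i \<otimes> b [^] j) x"
    and z: "z \<in> carrier G" "z \<otimes> a = a \<otimes> z" "z \<otimes> b = b \<otimes> z" "\<phi> z x = x"
  shows "z = \<one>"
proof (rule fixes_all_imp_one[OF z(1)])
  interpret group G by (rule action_group)
  fix y assume "y \<in> E"
  then obtain i j :: nat where y: "y = \<phi> (a [^] i \<otimes> b [^] j) x" using trans by blast
  have "z \<otimes> a [^] i = a [^] i \<otimes> z" "z \<otimes> b [^] j = b [^] j \<otimes> z"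
    using group_commutes_pow[OF z(2)[symmetric], of i] group_commutes_pow[OF z(3)[symmetric], of j] ab z
    by auto
  then have "z \<otimes> (a [^] i \<otimes> b [^] j) = (a [^] i \<otimes> b [^] j) \<otimes> z"
    using ab z(1) by (metis m_assoc nat_pow_closed)
  then show "\<phi> z y = y"
    using composition_rule[OF x, of z] composition_rule[OF x, of _ z] ab z y by (metis m_closed nat_pow_closed)
qed

text \<open>Subgroups of a cyclic normal subgroup are normal, so one that fixes a point fixes all of them.\<close>

lemma cyclic_normal_semiregular:
  assumes ab: "a \<in> carrier G" "b \<in> carrier G" and x: "x \<in> E"
    and r: "b \<otimes> a = a [^] (r::nat) \<otimes> b" and ordb: "group.ord G b \<noteq> 0"
    and trans: "\<And>y. y \<in> E \<Longrightarrow> \<exists>(i::nat) (j::nat). y = \<phi> (a [^] i \<otimes> b [^] j) x"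
    and fix_x: "\<phi> (a [^] (i::nat)) x = x"
  shows "a [^] i = \<one>"
proof -
  interpret group G by (rule action_group)
  have aG: "a [^] i \<in> carrier G" for i :: nat using ab by simp
  have bG: "b [^] i \<in> carrier G" for i :: nat using ab by simp
  show ?thesis
  proof (rule fixes_all_imp_one[OF aG])
    fix y assume "y \<in> E"
    then obtain u j :: nat where y: "y = \<phi> (a [^] u \<otimes> b [^] j) x" using trans by blast
    \<comment> \<open>\<open>b [^] j'\<close> is the inverse of \<open>b [^] j\<close>, written with
      a natural exponent, so that the relation between \<open>b\<close> and \<open>a\<close> can be
      applied to it.\<close>
    define j' s where "j' = j * (ord b - 1)" and "s = r ^ j'"
    have "j + j' = ord b * j"
      using ordb by (auto simp: j'_def algebra_simps diff_mult_distrib2)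
    then have bb: "b [^] j \<otimes> b [^] j' = \<one>" "b [^] j' \<otimes> b [^] j = \<one>"
      using ab by (simp_all add: nat_pow_mult pow_eq_id add.commute[of j' j])
    \<comment> \<open>Thus the action of \<open>a [^] i\<close> at \<open>y\<close> is carried back
      to that of \<open>a [^] (i * s)\<close> at \<open>x\<close>, which is a power of an element
      fixing \<open>x\<close>.\<close>
    have eq: "a [^] i \<otimes> b [^] j = b [^] j \<otimes> a [^] (i * s)"
    proof -
      have "b [^] j' \<otimes> a [^] i = a [^] (i * s) \<otimes> b [^] j'"
        unfolding s_def by (rule pow_conj_pow[OF ab r])
      then have "b [^] j \<otimes> (b [^] j' \<otimes> a [^] i) \<otimes> b [^] j = b [^] j \<otimes> (a [^] (i * s) \<otimes> b [^] j') \<otimes> b [^] j"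
        by simp
      moreover have "b [^] j \<otimes> (b [^] j' \<otimes> a [^] i) \<otimes> b [^] j = (b [^] j \<otimes> b [^] j') \<otimes> a [^] i \<otimes> b [^] j"
        using aG bG by (simp add: m_assoc)
      moreover have "b [^] j \<otimes> (a [^] (i * s) \<otimes> b [^] j') \<otimes> b [^] j = b [^] j \<otimes> a [^] (i * s) \<otimes> (b [^] j' \<otimes> b [^] j)"
        using aG bG by (simp add: m_assoc)
      ultimately show ?thesis using bb aG bG by simp
    qed
    have "(\<phi> (a [^] i) ^^ s) x = x" using fix_x by (induction s) auto
    then have fix_s: "\<phi> (a [^] (i * s)) x = x"
      using action_nat_pow[OF aG x, of i s] ab by (simp add: nat_pow_pow)
    have "a [^] i \<otimes> (a [^] u \<otimes> b [^] j) = a [^] u \<otimes> (a [^] i \<otimes> b [^] j)"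
      using ab aG bG by (simp add: nat_pow_mult add.commute flip: m_assoc)
    also have "\<dots> = (a [^] u \<otimes> b [^] j) \<otimes> a [^] (i * s)"
      unfolding eq using aG bG by (simp add: m_assoc)
    finally have "a [^] i \<otimes> (a [^] u \<otimes> b [^] j) = (a [^] u \<otimes> b [^] j) \<otimes> a [^] (i * s)" .
    then have "\<phi> (a [^] i) (\<phi> (a [^] u \<otimes> b [^] j) x) = \<phi> (a [^] u \<otimes> b [^] j) (\<phi> (a [^] (i * s)) x)"
      using composition_rule[OF x] aG bG by (metis m_closed)
    then show "\<phi> (a [^] i) y = y" using y fix_s by simp
  qed
qed

end

section \<open>Internal semidirect products with cyclic factors\<close>

context group begin

text \<open>\<open>N\<close> is normal in its normalizer, so its product with a subgroup
  \<open>H\<close> of the normalizer is a subgroup; normality of \<open>N\<close> then restricts to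
  this product.\<close>

lemma semidirect_product_in_normalizer:
  assumes N: "subgroup N G" and H: "subgroup H G" "H \<subseteq> normalizer G N" and "N \<inter> H = {\<one>}"
  shows "subgroup (N <#> H) G" "semidirect_product (G\<lparr>carrier := N <#> H\<rparr>) N H"
proof -
  let ?M = "normalizer G N" and ?R = "N <#> H"
  let ?GM = "G\<lparr>carrier := ?M\<rparr>"
  have NG: "N \<subseteq> carrier G" using N subgroup.subset by blast
  have M: "subgroup ?M G" using NG by (rule normalizer_imp_subgroup)
  interpret GM: group ?GM using M by (rule subgroup_imp_group)
  have nN: "N \<lhd> ?GM" using N by (rule subgroup_in_normalizer)
  have HM: "subgroup H ?GM" using subgroup_incl H M by blast
  have "subgroup (N <#>\<^bsub>?GM\<^esub> H) ?GM"
    using GM.mult_norm_subgroup[OF nN HM] .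
  then have RM: "subgroup ?R ?GM" by simp
  then show RG: "subgroup ?R G" using incl_subgroup[OF M] by blast
  have HG: "H \<subseteq> carrier G" using H subgroup.subset by blast
  have NR: "N \<subseteq> ?R"
  proof
    fix n assume "n \<in> N"
    then have "n = n \<otimes> \<one>" using NG by auto
    then show "n \<in> ?R" using \<open>n \<in> N\<close> subgroup.one_closed[OF H(1)] unfolding set_mult_def by blast
  qed
  have HR: "H \<subseteq> ?R"
  proof
    fix h assume "h \<in> H"
    then have "h = \<one> \<otimes> h" using HG by auto
    then show "h \<in> ?R" using \<open>h \<in> H\<close> subgroup.one_closed[OF N] unfolding set_mult_def by blast
  qed
  have "N \<lhd> ?GM\<lparr>carrier := ?R\<rparr>" using GM.normal_restrict_supergroup[OF RM nN NR] .
  moreover have "subgroup H (G\<lparr>carrier := ?R\<rparr>)" using subgroup_incl[OF H(1) RG HR] .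
  ultimately show "semidirect_product (G\<lparr>carrier := ?R\<rparr>) N H"
    using assms(4) by (simp add: semidirect_product_def)
qed

text \<open>Every coset of \<open>N\<close> has a representative in \<open>H\<close>, so the
  quotient is a homomorphic image of the cyclic group \<open>H\<close>.\<close>

lemma cyclic_FactGroup_semidirect_product:
  assumes sd: "semidirect_product G N H" and cyc: "cyclic_group (G\<lparr>carrier := H\<rparr>)"
  shows "cyclic_group (G Mod N)"
proof -
  have nN: "N \<lhd> G" and H: "subgroup H G" and R: "N <#> H = carrier G"
    using sd by (auto simp: semidirect_product_def)
  interpret normal N G by (rule nN)
  interpret H: group "G\<lparr>carrier := H\<rparr>" using H by (rule subgroup_imp_group)
  have HG: "H \<subseteq> carrier G" using H subgroup.subset by blast
  have "(\<lambda>a. N #> a) \<in> hom (G\<lparr>carrier := H\<rparr>) (G Mod N)"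
    using subsetD[OF HG] hom_mult[OF r_coset_hom_Mod] hom_in_carrier[OF r_coset_hom_Mod]
    by (intro homI) simp_all
  moreover have "carrier (G Mod N) \<subseteq> (\<lambda>a. N #> a) ` H"
  proof
    fix Y assume "Y \<in> carrier (G Mod N)"
    then obtain g where g: "g \<in> carrier G" "Y = N #> g" by (auto simp: FactGroup_def RCOSETS_def)
    then obtain n h where nh: "n \<in> N" "h \<in> H" "g = n \<otimes> h" using R unfolding set_mult_def by blast
    then have "N #> g = N #> n #> h" using subset HG by (metis coset_mult_assoc subsetD)
    then have "Y = N #> h" using g nh coset_join2[of n N] subgroup_axioms subset by auto
    then show "Y \<in> (\<lambda>a. N #> a) ` H" using nh by blast
  qed
  ultimately have "(\<lambda>a. N #> a) \<in> epi (G\<lparr>carrier := H\<rparr>) (G Mod N)"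
    by (auto simp: epi_def hom_def)
  then show ?thesis
    using H.cyclic_group_epimorphic_image cyc factorgroup_is_group by blast
qed

lemma split_metacyclicI:
  assumes "semidirect_product G N H"
    and "cyclic_group (G\<lparr>carrier := N\<rparr>)" "cyclic_group (G\<lparr>carrier := H\<rparr>)"
  shows "split_metacyclic G"
  using assms cyclic_FactGroup_semidirect_product[OF assms(1,3)]
  unfolding split_metacyclic_def metacyclic_def by (auto simp: semidirect_product_def)

lemma cyclic_group_generate_singleton:
  assumes "a \<in> carrier G"
  shows "cyclic_group (G\<lparr>carrier := generate G {a}\<rparr>)"
  using cyclic_group_generated[of a] assms by (simp add: subgroup_generated_def)

end

section \<open>Passage between metacirculant pairs and split metacyclic transitive groups\<close>

context faithful_action begin

text \<open>The witness is \<open>C <#> generate G {t}\<close>. It is transitive because powers of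
  \<open>t\<close> carry \<open>v\<close> into every \<open>C\<close>-orbit and \<open>C\<close> is
  transitive on each of them.\<close>

lemma metacirculant_imp_split:
  assumes fin: "finite (carrier G)" "finite E" and E: "card E = m * n" "n \<ge> 2"
    and s: "s \<in> carrier G" "group.ord G s = n"
  defines "C \<equiv> generate G {s}"
  defines "S \<equiv> G\<lparr>carrier := C\<rparr>"
  assumes semireg: "\<And>x. x \<in> E \<Longrightarrow> stabilizer S \<phi> x = {\<one>}"
    and t: "t \<in> normalizer G C"
    and cyc: "cyclic_on (\<lambda>B. \<phi> t ` B) (Group_Action.orbits S E \<phi>)"
    and v: "v \<in> E" "card (Orbits.orbit (\<phi> t) v) = m"
  shows "\<exists>R. subgroup R G \<and> split_metacyclic (G\<lparr>carrier := R\<rparr>) \<and>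
    transitive_action (G\<lparr>carrier := R\<rparr>) E \<phi>"
proof -
  interpret group G by (rule action_group)
  have C: "subgroup C G" unfolding C_def using s(1) generate_is_subgroup by simp
  interpret S: group_action S E \<phi> unfolding S_def using C by (rule induced_action)
  have tG: "t \<in> carrier G" using t mem_normalizer_iff C subgroup.subset by blast
  have ordt: "ord t \<noteq> 0" using ord_ge_1[OF fin(1) tG] by simp
  let ?T = "generate G {t}"
  have T: "subgroup ?T G" using tG generate_is_subgroup by simp
  have Tnat: "?T = range (\<lambda>i::nat. t [^] i)" using generate_singleton_nat[OF tG ordt] .
  have TN: "?T \<subseteq> normalizer G C"
    using t normalizer_imp_subgroup[of C] C subgroup.subset by (intro generate_subgroup_incl) auto
  have "order S = n" unfolding S_def C_def order_def using generate_pow_card[OF s(1)] s(2) by simp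
  then have cardO: "card (Group_Action.orbits S E \<phi>) = m"
    using S.card_semiregular[OF fin(2)] semireg E by (simp add: S_def)
  let ?f = "\<lambda>B. \<phi> t ` B" and ?O = "Group_Action.orbit S \<phi>"
  have orbs: "Group_Action.orbits S E \<phi> = Orbits.orbit ?f (?O v)"
    using cyc v(1) unfolding cyclic_on_alldef by (auto simp: orbits_def)
  have fp: "(?f ^^ j) (?O v) = ?O (\<phi> (t [^] j) v)" for j
    unfolding S_def by (rule funpow_image_orbit_normalizer[OF C t v(1)])
  have period: "\<phi> (t [^] ord t) v = v" using tG v(1) by (simp add: action_one)
  \<comment> \<open>The number \<open>m\<close> is both the number of \<open>C\<close>-orbits and
    the cycle length of \<open>t\<close> at \<open>v\<close>: fixing the orbit of \<open>v\<close>
    gives \<open>m dvd j\<close>, and \<open>m dvd j\<close> gives that \<open>v\<close> itself is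
    fixed.\<close>
  have trivial: "t [^] j = \<one>" if "t [^] j \<in> C" for j :: nat
  proof -
    have "\<phi> (t [^] j) v \<in> ?O v" using that by (auto simp: Group_Action.orbit_def S_def)
    then have "(?f ^^ j) (?O v) = ?O v"
      using fp S.orbit_eq_iff v(1) tG action_closed by simp
    moreover have "(?f ^^ ord t) (?O v) = ?O v" using fp period by simp
    ultimately have "m dvd j"
      using funpow_eq_self_iff[of "ord t" ?f "?O v" j] ordt orbs cardO by simp
    then have "(\<phi> t ^^ j) v = v"
      using funpow_eq_self_iff[of "ord t" "\<phi> t" v j] ordt period action_nat_pow[OF tG v(1)] v(2) by simp
    then have "t [^] j \<in> stabilizer S \<phi> v"
      using that action_nat_pow[OF tG v(1)] by (simp add: stabilizer_def S_def)
    then show ?thesis using semireg[OF v(1)] by simp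
  qed
  have "C \<inter> ?T = {\<one>}"
    using trivial subgroup.one_closed[OF C] subgroup.one_closed[OF T] unfolding Tnat by auto
  note sd = semidirect_product_in_normalizer[OF C T TN this]
  let ?R = "C <#> ?T"
  interpret R: group "G\<lparr>carrier := ?R\<rparr>" using sd(1) by (rule subgroup_imp_group)
  have "cyclic_group (G\<lparr>carrier := C\<rparr>)" "cyclic_group (G\<lparr>carrier := ?T\<rparr>)"
    unfolding C_def using cyclic_group_generate_singleton s(1) tG by blast+
  then have "split_metacyclic (G\<lparr>carrier := ?R\<rparr>)"
    using R.split_metacyclicI[OF sd(2)] by simp
  moreover have "transitive_action (G\<lparr>carrier := ?R\<rparr>) E \<phi>"
  proof -
    have reach: "\<exists>g\<in>?R. \<phi> g v = y" if y: "y \<in> E" for y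
    proof -
      have "?O y \<in> Orbits.orbit ?f (?O v)" using y orbs by (auto simp: orbits_def)
      then obtain j where "?O y = ?O (\<phi> (t [^] (j::nat)) v)" using fp unfolding orbit_altdef by auto
      then have "y \<in> ?O (\<phi> (t [^] j) v)" using S.orbit_refl[OF y] by simp
      then obtain c where c: "c \<in> C" "y = \<phi> c (\<phi> (t [^] j) v)"
        by (auto simp: Group_Action.orbit_def S_def)
      then have "\<phi> (c \<otimes> t [^] j) v = y"
        using composition_rule[OF v(1)] tG subgroup.mem_carrier[OF C] by auto
      moreover have "c \<otimes> t [^] j \<in> ?R" using c(1) Tnat by (auto simp: set_mult_def)
      ultimately show ?thesis by blast
    qed
    interpret RA: group_action "G\<lparr>carrier := ?R\<rparr>" E \<phi> using sd(1) by (rule induced_action)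
    show ?thesis
    proof (intro transitive_action.intro transitive_action_axioms.intro RA.group_action_axioms)
      fix x y assume xy: "x \<in> E" "y \<in> E"
      obtain g h where gh: "g \<in> ?R" "\<phi> g v = x" "h \<in> ?R" "\<phi> h v = y" using reach xy by metis
      then have "y \<in> Group_Action.orbit (G\<lparr>carrier := ?R\<rparr>) \<phi> v" "x \<in> Group_Action.orbit (G\<lparr>carrier := ?R\<rparr>) \<phi> v"
        by (auto simp: Group_Action.orbit_def)
      then have "y \<in> Group_Action.orbit (G\<lparr>carrier := ?R\<rparr>) \<phi> x"
        using RA.orbit_sym RA.orbit_trans xy v(1) by metis
      then show "\<exists>g\<in>carrier (G\<lparr>carrier := ?R\<rparr>). \<phi> g x = y" by (auto simp: Group_Action.orbit_def)
    qed
  qed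
  ultimately show ?thesis using sd(1) by blast
qed

text \<open>The hypothesis \<open>disj\<^sub>0\<close> expresses that the cyclic groups of
  \<open>a\<close> and \<open>b\<^sub>0\<close> meet trivially. The conclusions are the clauses on
  \<sigma> and \<tau> in the definition of a metacirculant, with \<open>a\<close> for
  \<sigma>.\<close>

lemma ex_metacirculant_pair:
  assumes fin: "finite (carrier G)" "finite E"
    and p: "Factorial_Ring.prime p" "odd p" and E: "card E = p ^ k"
    and ab: "a \<in> carrier G" "b\<^sub>0 \<in> carrier G" and a1: "a \<noteq> \<one>"
    and r\<^sub>0: "b\<^sub>0 \<otimes> a = a [^] (r\<^sub>0::nat) \<otimes> b\<^sub>0"
    and disj\<^sub>0: "\<And>(i::nat) (j::nat). a [^] i \<otimes> b\<^sub>0 [^] j = \<one> \<Longrightarrow> b\<^sub>0 [^] j = \<one>"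
    and trans\<^sub>0: "\<And>x y. x \<in> E \<Longrightarrow> y \<in> E \<Longrightarrow> \<exists>(i::nat) (j::nat). y = \<phi> (a [^] i \<otimes> b\<^sub>0 [^] j) x"
  defines "S \<equiv> G\<lparr>carrier := generate G {a}\<rparr>"
  shows "card E = card (Group_Action.orbits S E \<phi>) * group.ord G a"
    and "\<forall>x\<in>E. stabilizer S \<phi> x = {\<one>}"
    and "\<exists>t\<in>normalizer G (generate G {a}).
      cyclic_on (\<lambda>B. \<phi> t ` B) (Group_Action.orbits S E \<phi>) \<and>
      (\<exists>x\<in>E. card (Orbits.orbit (\<phi> t) x) = card (Group_Action.orbits S E \<phi>))"
proof -
  interpret group G by (rule action_group)
  define C where "C = generate G {a}"
  let ?O = "Group_Action.orbit S \<phi>"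
  define m where "m = card (Group_Action.orbits S E \<phi>)"
  have orda0: "ord a \<noteq> 0" using ord_ge_1[OF fin(1) ab(1)] by simp
  have ordb0: "ord b\<^sub>0 \<noteq> 0" using ord_ge_1[OF fin(1) ab(2)] by simp
  have C: "subgroup C G" unfolding C_def using ab(1) generate_is_subgroup by simp
  have Cnat: "C = range (\<lambda>i::nat. a [^] i)"
    unfolding C_def using generate_singleton_nat[OF ab(1) orda0] .
  have S: "S = G\<lparr>carrier := C\<rparr>" by (simp add: S_def C_def)
  interpret S: group_action S E \<phi> unfolding S using C by (rule induced_action)
  have memO: "y \<in> ?O x \<longleftrightarrow> (\<exists>i::nat. y = \<phi> (a [^] i) x)" for x y
    by (auto simp: S Cnat Group_Action.orbit_def)
  have semireg: "a [^] i = \<one>" if "x \<in> E" "\<phi> (a [^] i) x = x" for x and i :: nat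
    using cyclic_normal_semiregular[OF ab that(1) r\<^sub>0 ordb0 trans\<^sub>0[OF that(1)] that(2)] .
  have stab: "stabilizer S \<phi> x = {\<one>}" if "x \<in> E" for x
    using semireg[OF that] action_one[OF that] subgroup.one_closed[OF C]
    by (auto simp: stabilizer_def S Cnat)
  then show "\<forall>x\<in>E. stabilizer S \<phi> x = {\<one>}" by blast
  have "order S = ord a" unfolding S_def order_def using generate_pow_card[OF ab(1)] by simp
  then have cardE: "card E = m * ord a"
    unfolding m_def using S.card_semiregular[OF fin(2)] stab by (simp add: S)
  then show "card E = card (Group_Action.orbits S E \<phi>) * ord a" by (simp add: m_def)
  have "m dvd p ^ k" "ord a dvd p ^ k" using cardE E by (auto intro: dvdI)
  then obtain d f where d: "m = p ^ d" and f: "ord a = p ^ f"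
    using divides_primepow_nat[OF p(1)] by auto
  have f0: "f \<noteq> 0" using f a1 ord_eq_1[OF ab(1)] by (intro notI) simp
  have "card E \<noteq> 0" using E p(1) by (auto simp: prime_gt_0_nat)
  then obtain x where x: "x \<in> E" by fastforce

  have b\<^sub>0N: "b\<^sub>0 \<in> normalizer G C"
    unfolding C_def by (rule conj_pow_imp_mem_normalizer[OF ab r\<^sub>0 orda0])
  have cover\<^sub>0: "\<exists>j::nat. y \<in> ?O (\<phi> (b\<^sub>0 [^] j) x)" if y: "y \<in> E" for y
  proof -
    obtain i j :: nat where "y = \<phi> (a [^] i \<otimes> b\<^sub>0 [^] j) x" using trans\<^sub>0[OF x y] by blast
    then have "y = \<phi> (a [^] i) (\<phi> (b\<^sub>0 [^] j) x)" using composition_rule[OF x] ab by simp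
    then show ?thesis using memO by blast
  qed
  note cyc\<^sub>0 = normalizer_cyclic_on_orbits[OF C b\<^sub>0N x ordb0, folded S, OF cover\<^sub>0, folded m_def]

  \<comment> \<open>\<open>h\<close> is the part of the order prime to \<open>p\<close>, so
    \<open>b\<^sub>0 [^] h\<close> generates the Sylow \<open>p\<close>-subgroup of the cyclic group
    of \<open>b\<^sub>0\<close>.\<close>
  obtain h where h: "ord b\<^sub>0 = p ^ multiplicity p (ord b\<^sub>0) * h" "\<not> p dvd h"
    using multiplicity_decompose'[of "ord b\<^sub>0" p] ordb0 p(1) by (metis not_prime_unit)
  define b e r where "b = b\<^sub>0 [^] h" and "e = multiplicity p (ord b\<^sub>0)" and "r = r\<^sub>0 ^ h"
  have h0: "h \<noteq> 0" using h(2) by (metis dvd_0_right)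
  have bG: "b \<in> carrier G" using ab by (simp add: b_def)
  note ab' = ab(1) bG
  have ordb: "ord b = p ^ e"
    unfolding b_def using ord_pow[OF ab(2), of h] h h0 e_def by (metis dvd_triv_right nonzero_mult_div_cancel_right)
  have r: "b \<otimes> a = a [^] r \<otimes> b"
    unfolding b_def r_def using pow_conj_pow[OF ab r\<^sub>0, of h 1] ab by simp
  have disj: "b [^] j = \<one>" if "a [^] i \<otimes> b [^] j = \<one>" for i j :: nat
    using disj\<^sub>0[of i "h * j"] that ab by (simp add: b_def nat_pow_pow)
  have bN: "b \<in> normalizer G C"
    unfolding C_def by (rule conj_pow_imp_mem_normalizer[OF ab' r orda0])
  have ordb': "ord b \<noteq> 0" using ord_ge_1[OF fin(1) bG] by simp
  have cover: "\<exists>j::nat. y \<in> ?O (\<phi> (b [^] j) x)" if y: "y \<in> E" for y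
  proof -
    obtain j where j: "y \<in> ?O (\<phi> (b\<^sub>0 [^] (j::nat)) x)" using cover\<^sub>0[OF y] by blast
    \<comment> \<open>The action of \<open>b\<^sub>0\<close> on the \<open>C\<close>-orbits has
      order \<open>m = p ^ d\<close>, prime to \<open>h\<close>; hence powers of \<open>b\<close>
      reach every orbit that powers of \<open>b\<^sub>0\<close> reach.\<close>
    have "coprime h m"
      using prime_imp_coprime[OF p(1) h(2)] d by (simp add: coprime_commute)
    then obtain l where l: "[h * l = j] (mod m)" using cong_solve_dvd_nat[of h m j] by auto
    have fp: "((\<lambda>B. \<phi> b\<^sub>0 ` B) ^^ j) (?O x) = ?O (\<phi> (b\<^sub>0 [^] j) x)" for j
      unfolding S by (rule funpow_image_orbit_normalizer[OF C b\<^sub>0N x])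
    have "((\<lambda>B. \<phi> b\<^sub>0 ` B) ^^ m) (?O x) = ?O x" using fp cyc\<^sub>0(2)[of m] by simp
    from funpow_mod_eq[OF this, of j] funpow_mod_eq[OF this, of "h * l"]
    have "?O (\<phi> (b\<^sub>0 [^] (h * l)) x) = ?O (\<phi> (b\<^sub>0 [^] j) x)"
      using l fp by (simp add: cong_def)
    then show ?thesis using j ab by (auto simp: b_def nat_pow_pow)
  qed
  have trans: "\<exists>(i::nat) (j::nat). y = \<phi> (a [^] i \<otimes> b [^] j) x" if "y \<in> E" for y
    using cover[OF that] composition_rule[OF x] ab' unfolding memO by (metis nat_pow_closed)
  note cyc = normalizer_cyclic_on_orbits[OF C bN x ordb', folded S, OF cover, folded m_def]

  have "m dvd ord b" using cyc(2)[of "ord b"] bG action_one[OF x] by simp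
  then have de: "d \<le> e" using d ordb power_dvd_imp_le prime_gt_1_nat[OF p(1)] by metis
  define K where "K = stabilizer G \<phi> x"
  have memK: "g \<in> K \<longleftrightarrow> g \<in> carrier G \<and> \<phi> g x = x" for g by (simp add: K_def stabilizer_def)
  \<comment> \<open>\<open>b [^] m\<close> fixes the \<open>C\<close>-orbit of \<open>x\<close>, so
    some power of \<open>a\<close> brings the image of \<open>x\<close> back to
    \<open>x\<close>.\<close>
  have "x \<in> ?O (\<phi> (b [^] m) x)"
    using cyc(2)[of m] S.orbit_refl[OF x] by simp
  then obtain i :: nat where "x = \<phi> (a [^] i) (\<phi> (b [^] m) x)" using memO by blast
  then have iK: "a [^] i \<otimes> b [^] (p ^ d) \<in> K"
    using composition_rule[OF x] ab' d by (simp add: memK)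
  have "\<exists>j::nat. (a [^] j \<otimes> b) [^] (p ^ d) \<in> K"
  proof (rule ex_prime_power_root_in_core_free[OF p ab' r f f0 ordb disj _ _ _ de iK])
    show "subgroup K G" unfolding K_def by (rule stabilizer_subgroup[OF x])
    show "a [^] i = \<one>" if "a [^] i \<in> K" for i :: nat using that semireg[OF x] memK by blast
    show "z = \<one>" if "z \<in> K" "z \<otimes> a = a \<otimes> z" "z \<otimes> b = b \<otimes> z" for z
      using commuting_fixes_imp_one[OF ab' x trans _ that(2,3)] that(1) memK by blast
  qed auto
  then obtain j :: nat where j: "(a [^] j \<otimes> b) [^] m \<in> K" using d by blast
  define t where "t = a [^] j \<otimes> b"
  have tG: "t \<in> carrier G" using ab' by (simp add: t_def)
  have ordt: "ord t \<noteq> 0" using ord_ge_1[OF fin(1) tG] by simp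
  have rt: "t \<otimes> a = a [^] r \<otimes> t"
  proof -
    have "t \<otimes> a = a [^] j \<otimes> (b \<otimes> a)" using ab' by (simp add: t_def m_assoc)
    also have "\<dots> = (a [^] j \<otimes> a [^] r) \<otimes> b" using ab' r by (simp add: m_assoc)
    also have "\<dots> = a [^] r \<otimes> t" using ab' by (simp add: t_def nat_pow_mult add.commute flip: m_assoc)
    finally show ?thesis .
  qed
  have tN: "t \<in> normalizer G C"
    unfolding C_def by (rule conj_pow_imp_mem_normalizer[OF ab(1) tG rt orda0])
  \<comment> \<open>\<open>t [^] l\<close> differs from \<open>b [^] l\<close> by a power of
    \<open>a\<close> on the left, so both send \<open>x\<close> into the same
    \<open>C\<close>-orbit.\<close>
  have cover_t: "\<exists>l::nat. y \<in> ?O (\<phi> (t [^] l) x)" if y: "y \<in> E" for y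
  proof -
    obtain l where l: "y \<in> ?O (\<phi> (b [^] (l::nat)) x)" using cover[OF y] by blast
    have "t [^] l = a [^] (j * (\<Sum>i<l. r ^ i)) \<otimes> b [^] l"
      unfolding t_def by (rule pow_mult_conj[OF ab' r])
    then have "\<phi> (t [^] l) x \<in> ?O (\<phi> (b [^] l) x)"
      using memO composition_rule[OF x] ab' by auto
    then have "?O (\<phi> (t [^] l) x) = ?O (\<phi> (b [^] l) x)"
      using S.orbit_eq_iff action_closed x tG bG by simp
    then show ?thesis using l by blast
  qed
  note cyc_t = normalizer_cyclic_on_orbits[OF C tN x ordt, folded S, OF cover_t, folded m_def]
  have fp: "(\<phi> t ^^ l) x = \<phi> (t [^] l) x" for l using action_nat_pow[OF tG x] by simp
  have period: "(\<phi> t ^^ ord t) x = x" using fp tG action_one[OF x] by simp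
  have iff: "(\<phi> t ^^ l) x = x \<longleftrightarrow> card (Orbits.orbit (\<phi> t) x) dvd l" for l
    using funpow_eq_self_iff[OF _ period] ordt by simp
  have "(\<phi> t ^^ m) x = x" using j memK fp t_def by simp
  then have "card (Orbits.orbit (\<phi> t) x) dvd m" using iff by blast
  \<comment> \<open>A power of \<open>t\<close> fixing \<open>x\<close> also fixes its
    \<open>C\<close>-orbit, so its exponent is a multiple of \<open>m\<close>.\<close>
  moreover have "m dvd card (Orbits.orbit (\<phi> t) x)"
    using cyc_t(2) iff fp by (metis dvd_refl)
  ultimately have "card (Orbits.orbit (\<phi> t) x) = m" by (rule dvd_antisym)
  then show "\<exists>t\<in>normalizer G (generate G {a}).
      cyclic_on (\<lambda>B. \<phi> t ` B) (Group_Action.orbits S E \<phi>) \<and>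
      (\<exists>x\<in>E. card (Orbits.orbit (\<phi> t) x) = card (Group_Action.orbits S E \<phi>))"
    using tN cyc_t(1) x unfolding C_def m_def by blast
qed

end

section \<open>Cyclic subgroups and automorphism groups of finite graphs\<close>

lemma (in group) cyclic_subgroup_nat_pow:
  assumes "finite (carrier G)" and N: "subgroup N G" and cyc: "cyclic_group (G\<lparr>carrier := N\<rparr>)"
  shows "\<exists>a\<in>N. N = range (\<lambda>i::nat. a [^] i)"
proof -
  obtain a where "a \<in> carrier (G\<lparr>carrier := N\<rparr>)"
    and gen: "subgroup_generated (G\<lparr>carrier := N\<rparr>) {a} = G\<lparr>carrier := N\<rparr>"
    using cyc unfolding cyclic_group_def by blast
  then have a: "a \<in> N" by simp
  have aG: "a \<in> carrier G" by (rule subgroup.mem_carrier[OF N a])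
  have "carrier (subgroup_generated (G\<lparr>carrier := N\<rparr>) {a}) = N" unfolding gen by simp
  then have "generate (G\<lparr>carrier := N\<rparr>) {a} = N"
    using a by (simp add: carrier_subgroup_generated)
  then have "N = generate G {a}" using generate_consistent[OF _ N, of "{a}"] a by simp
  then show ?thesis
    using a generate_singleton_nat[OF aG] ord_ge_1[OF assms(1) aG]
    by (metis not_one_le_zero)
qed

text \<open>The action is the inclusion of the automorphisms into the permutations of the vertices,
  and \<open>id\<close> is injective.\<close>

lemma faithful_action_GraphAut: "faithful_action (GraphAut \<Gamma>) (pverts \<Gamma>) id"
proof -
  let ?B = "BijGroup (pverts \<Gamma>)"
  have "group_action ?B (pverts \<Gamma>) id"
    unfolding group_action_def
    by (intro group_hom.intro group_hom_axioms.intro group_BijGroup) (simp add: hom_def)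
  from group_action.induced_action[OF this subgroup_graph_auto]
  show ?thesis
    by (intro faithful_action.intro faithful_action_axioms.intro) (simp_all add: GraphAut_def)
qed

lemma finite_GraphAut:
  assumes "finite (pverts \<Gamma>)"
  shows "finite (carrier (GraphAut \<Gamma>))"
proof (rule finite_subset)
  show "carrier (GraphAut \<Gamma>) \<subseteq> pverts \<Gamma> \<rightarrow>\<^sub>E pverts \<Gamma>"
  proof
    fix f assume "f \<in> carrier (GraphAut \<Gamma>)"
    then have "f \<in> Bij (pverts \<Gamma>)" by (simp add: GraphAut_def graph_auto_def)
    then show "f \<in> pverts \<Gamma> \<rightarrow>\<^sub>E pverts \<Gamma>"
      using Bij_imp_extensional[of f] Bij_imp_funcset[of f] unfolding PiE_def by blast
  qed
  show "finite (pverts \<Gamma> \<rightarrow>\<^sub>E pverts \<Gamma>)" using assms by (intro finite_PiE)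
qed

section \<open>The equivalence for graphs of odd prime power order\<close>

theorem theorem1p1:
  fixes \<Gamma> :: "'a pair_pre_digraph" and p k :: nat
  assumes "pair_graph \<Gamma>"
    and "Digraph_Component.connected (with_proj \<Gamma>)"
    and "weak_metacirculant \<Gamma>"
    and "Factorial_Ring.prime p" and "odd p" and "k \<ge> 1" and "card (pverts \<Gamma>) = p ^ k"
  shows "metacirculant \<Gamma> \<longleftrightarrow> split_weak_metacirculant \<Gamma>"
proof
  let ?G = "GraphAut \<Gamma>"
  interpret faithful_action "GraphAut \<Gamma>" "pverts \<Gamma>" id by (rule faithful_action_GraphAut)
  interpret group "GraphAut \<Gamma>" by (rule group_GraphAut)
  have card1: "card (pverts \<Gamma>) > 1"
    unfolding assms(7) using prime_gt_1_nat[OF assms(4)] assms(6) by (intro one_less_power) auto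
  then have finE: "finite (pverts \<Gamma>)" by (intro card_ge_0_finite) simp
  then have finG: "finite (carrier ?G)" by (rule finite_GraphAut)
  {
    assume "metacirculant \<Gamma>"
    then obtain m n where "mn_metacirculant m n \<Gamma>" unfolding metacirculant_def by blast
    then obtain s t where
      "card (pverts \<Gamma>) = m * n" "n \<ge> 2" "s \<in> carrier ?G" "ord s = n"
      "\<forall>v\<in>pverts \<Gamma>. stabilizer (?G\<lparr>carrier := generate ?G {s}\<rparr>) id v =
        {\<one>\<^bsub>?G\<lparr>carrier := generate ?G {s}\<rparr>\<^esub>}"
      "t \<in> normalizer ?G (generate ?G {s})"
      "cyclic_on (\<lambda>B. t ` B) (Group_Action.orbits (?G\<lparr>carrier := generate ?G {s}\<rparr>) (pverts \<Gamma>) id)"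
      "\<exists>v\<in>pverts \<Gamma>. card (Orbits.orbit t v) = m"
      unfolding mn_metacirculant_def Let_def by blast
    then have "\<exists>R. subgroup R ?G \<and> split_metacyclic (?G\<lparr>carrier := R\<rparr>) \<and>
        transitive_action (?G\<lparr>carrier := R\<rparr>) (pverts \<Gamma>) id"
      using metacirculant_imp_split[OF finG finE, of m n s t] by auto
    then show "split_weak_metacirculant \<Gamma>"
      using assms(3) by (simp add: split_weak_metacirculant_def)
  }
  \<comment> \<open>Stated for arbitrary \<open>a\<close> and \<open>b\<close> because it is applied
    twice: to generators of \<open>N\<close> and \<open>H\<close>, and to a generator of
    \<open>H\<close> with the identity when \<open>N\<close> is trivial.\<close>
  have metacirculantI: "metacirculant \<Gamma>"
    if ab: "a \<in> carrier ?G" "b \<in> carrier ?G" "a \<noteq> \<one>\<^bsub>?G\<^esub>"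
      "b \<otimes>\<^bsub>?G\<^esub> a = a [^]\<^bsub>?G\<^esub> r \<otimes>\<^bsub>?G\<^esub> b"
      and disj: "\<And>(i::nat) (j::nat). a [^]\<^bsub>?G\<^esub> i \<otimes>\<^bsub>?G\<^esub> b [^]\<^bsub>?G\<^esub> j = \<one>\<^bsub>?G\<^esub>
        \<Longrightarrow> b [^]\<^bsub>?G\<^esub> j = \<one>\<^bsub>?G\<^esub>"
      and tr: "\<And>x y. x \<in> pverts \<Gamma> \<Longrightarrow> y \<in> pverts \<Gamma> \<Longrightarrow>
        \<exists>(i::nat) (j::nat). y = (a [^]\<^bsub>?G\<^esub> i \<otimes>\<^bsub>?G\<^esub> b [^]\<^bsub>?G\<^esub> j) x"
    for a b and r :: nat
  proof -
    let ?S = "?G\<lparr>carrier := generate ?G {a}\<rparr>"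
    let ?m = "card (Group_Action.orbits ?S (pverts \<Gamma>) id)"
    have trans: "\<exists>(i::nat) (j::nat). y = id (a [^]\<^bsub>?G\<^esub> i \<otimes>\<^bsub>?G\<^esub> b [^]\<^bsub>?G\<^esub> j) x"
      if "x \<in> pverts \<Gamma>" "y \<in> pverts \<Gamma>" for x y
      using tr[OF that] by simp
    note pair = ex_metacirculant_pair[OF finG finE assms(4,5,7) ab]
    have card_eq: "card (pverts \<Gamma>) = ?m * ord a"
      using pair(1) disj trans by blast
    have semireg: "\<forall>x\<in>pverts \<Gamma>. stabilizer ?S id x = {\<one>\<^bsub>?G\<^esub>}"
      using pair(2) disj trans by blast
    have "?m \<ge> 1" using card_eq card1 by (cases ?m) auto
    moreover have "ord a \<ge> 2"
      using ord_ge_1[OF finG ab(1)] ord_eq_1[OF ab(1)] ab(3) by linarith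
    moreover obtain t where "t \<in> normalizer ?G (generate ?G {a})"
      "cyclic_on (\<lambda>B. t ` B) (Group_Action.orbits ?S (pverts \<Gamma>) id)"
      "\<exists>x\<in>pverts \<Gamma>. card (Orbits.orbit t x) = ?m"
      using pair(3) disj trans by simp blast
    moreover have "t \<in> carrier ?G"
      using calculation(3) mem_normalizer_iff generate_incl ab(1) by auto
    ultimately have "mn_metacirculant ?m (ord a) \<Gamma>"
      using card_eq semireg ab(1) unfolding mn_metacirculant_def Let_def by auto
    then show ?thesis unfolding metacirculant_def by blast
  qed
  assume "split_weak_metacirculant \<Gamma>"
  then obtain R where R: "subgroup R ?G" "split_metacyclic (?G\<lparr>carrier := R\<rparr>)"
      "transitive_action (?G\<lparr>carrier := R\<rparr>) (pverts \<Gamma>) id"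
    unfolding split_weak_metacirculant_def by blast
  let ?R = "?G\<lparr>carrier := R\<rparr>"
  interpret R: group ?R using R(1) by (rule subgroup_imp_group)
  obtain N H where sd: "semidirect_product ?R N H"
    and cyc: "cyclic_group (?G\<lparr>carrier := N\<rparr>)" "cyclic_group (?G\<lparr>carrier := H\<rparr>)"
    using R(2) unfolding split_metacyclic_def by auto
  have nN: "N \<lhd> ?R" and H: "subgroup H ?G" and NH: "N \<inter> H = {\<one>\<^bsub>?G\<^esub>}" "N <#>\<^bsub>?G\<^esub> H = R"
    using sd incl_subgroup[OF R(1)] by (auto simp: semidirect_product_def)
  have NR: "subgroup N ?R" using nN R.normal_inv_iff by blast
  then have N: "subgroup N ?G" using incl_subgroup[OF R(1)] by blast
  obtain a b where ab: "a \<in> N" "b \<in> H"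
    and pows: "N = range (\<lambda>i::nat. a [^]\<^bsub>?G\<^esub> i)" "H = range (\<lambda>i::nat. b [^]\<^bsub>?G\<^esub> i)"
    using cyclic_subgroup_nat_pow[OF finG N cyc(1)] cyclic_subgroup_nat_pow[OF finG H cyc(2)] by blast
  have aG: "a \<in> carrier ?G" and bG: "b \<in> carrier ?G"
    using ab subgroup.mem_carrier[OF N] subgroup.mem_carrier[OF H] by blast+
  have "b \<in> R"
  proof -
    have "b = \<one>\<^bsub>?G\<^esub> \<otimes>\<^bsub>?G\<^esub> b" using bG by simp
    then show ?thesis using NH(2) ab(2) subgroup.one_closed[OF N] unfolding set_mult_def by blast
  qed
  then have "b \<otimes>\<^bsub>?R\<^esub> a \<otimes>\<^bsub>?R\<^esub> inv\<^bsub>?R\<^esub> b \<in> N" using R.normal_invE(2)[OF nN] ab(1) by simp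
  then have "b \<otimes>\<^bsub>?G\<^esub> a \<otimes>\<^bsub>?G\<^esub> inv\<^bsub>?G\<^esub> b \<in> N" using m_inv_consistent[OF R(1) \<open>b \<in> R\<close>] by simp
  then obtain r :: nat where "b \<otimes>\<^bsub>?G\<^esub> a \<otimes>\<^bsub>?G\<^esub> inv\<^bsub>?G\<^esub> b = a [^]\<^bsub>?G\<^esub> r" using pows(1) by blast
  then have r: "b \<otimes>\<^bsub>?G\<^esub> a = a [^]\<^bsub>?G\<^esub> r \<otimes>\<^bsub>?G\<^esub> b"
    using aG bG by (metis inv_closed inv_solve_right m_closed nat_pow_closed)
  \<comment> \<open>Such a relation puts the power of \<open>b\<close> into both \<open>N\<close>
    and \<open>H\<close>.\<close>
  have disj: "b [^]\<^bsub>?G\<^esub> j = \<one>\<^bsub>?G\<^esub>" if "a [^]\<^bsub>?G\<^esub> i \<otimes>\<^bsub>?G\<^esub> b [^]\<^bsub>?G\<^esub> j = \<one>\<^bsub>?G\<^esub>" for i j :: nat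
  proof -
    have "b [^]\<^bsub>?G\<^esub> j = inv\<^bsub>?G\<^esub> (a [^]\<^bsub>?G\<^esub> i)"
      using inv_equality[OF that] aG bG by (metis inv_inv nat_pow_closed)
    moreover have "inv\<^bsub>?G\<^esub> (a [^]\<^bsub>?G\<^esub> i) \<in> N" using pows(1) subgroup.m_inv_closed[OF N] by blast
    moreover have "b [^]\<^bsub>?G\<^esub> j \<in> H" using pows(2) by blast
    ultimately show ?thesis using NH(1) by auto
  qed
  have trans: "\<exists>(i::nat) (j::nat). y = (a [^]\<^bsub>?G\<^esub> i \<otimes>\<^bsub>?G\<^esub> b [^]\<^bsub>?G\<^esub> j) x"
    if xy: "x \<in> pverts \<Gamma>" "y \<in> pverts \<Gamma>" for x y
  proof -
    obtain g where "g \<in> R" "g x = y"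
      using transitive_action.unique_orbit[OF R(3) xy] by auto
    then show ?thesis using NH(2) pows unfolding set_mult_def by blast
  qed
  show "metacirculant \<Gamma>"
  proof (cases "a = \<one>\<^bsub>?G\<^esub>")
    case False
    show ?thesis by (rule metacirculantI[OF aG bG False r]) (fact disj, fact trans)
  next
    \<comment> \<open>A metacirculant has \<open>n \<ge> 2\<close>, so a trivial normal factor
      cannot provide \<sigma>. The group is then cyclic, and its generator \<open>b\<close> takes
      the place of \<open>a\<close>, with the identity as complement.\<close>
    case True
    have trans_b: "\<exists>j::nat. y = (b [^]\<^bsub>?G\<^esub> j) x" if "x \<in> pverts \<Gamma>" "y \<in> pverts \<Gamma>" for x y
      using trans[OF that] True bG by simp
    have "b \<noteq> \<one>\<^bsub>?G\<^esub>"
    proof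
      assume "b = \<one>\<^bsub>?G\<^esub>"
      then have "x = y" if "x \<in> pverts \<Gamma>" "y \<in> pverts \<Gamma>" for x y
        using trans_b[OF that] action_one[OF that(1)] by simp
      then show False using card1 by (metis card_le_Suc0_iff_eq finE not_less One_nat_def)
    qed
    then show ?thesis
      using metacirculantI[of b "\<one>\<^bsub>?G\<^esub>" 1] bG trans_b by simp
  qed
qed

end
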